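(* Let $G$ be a connected graph with at least one edge. Then $$\inf_{\omega\in W} t_\omega(G)=\min_{S\in Co(G)}\frac{|S|-1}{e(G[S])},$$ where $Co(G)=\{S\subseteq V(G)\,:\, G[S]\text{ is connected}\}$.
   Context: Graphs are finite, simple and undirected. $G[S]$ is the subgraph induced by $S$ and $e(H)$ is the number of edges of $H$. Let $W$ be the set of functions $\omega:E(G)\to\mathbb{R}_{\ge 0}$ that are not identically zero. Write $\omega(H)=\sum_{e\in E(H)}\omega(e)$ and $\omega(G)=\sum_{e\in E(G)}\omega(e)$. Let $T_\omega$ be a maximum spanning tree of $G$ with respect to $\omega$, i.e. a spanning tree maximizing $\omega(T)$. The weighting ratio is $t_\omega(G)=\omega(T_\omega)/\omega(G)$. In the minimum over $Co(G)$ only sets $S$ with $|S|\ge 2$ are considered, since otherwise the quotient is $0/0$. *)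

theory Defs
  imports Complex_Main
begin

record 'a ugraph =
  verts :: "'a set"
  edges :: "'a set set"

definition simple_graph :: "'a ugraph \<Rightarrow> bool" where
  "simple_graph G \<longleftrightarrow> finite (verts G) \<and> (\<forall>e\<in>edges G. e \<subseteq> verts G \<and> card e = 2)"

definition adj :: "'a ugraph \<Rightarrow> 'a rel" where
  "adj G = {(u, v). {u, v} \<in> edges G}"

definition connected_graph :: "'a ugraph \<Rightarrow> bool" where
  "connected_graph G \<longleftrightarrow> verts G \<noteq> {} \<and> (\<forall>u\<in>verts G. \<forall>v\<in>verts G. (u, v) \<in> (adj G)\<^sup>*)"

text \<open>A cycle is given by its cyclic sequence of distinct vertices, without repeating the first one.\<close>

definition is_cycle :: "'a ugraph \<Rightarrow> 'a list \<Rightarrow> bool" where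
  "is_cycle G vs \<longleftrightarrow> 3 \<le> length vs \<and> distinct vs \<and>
     (\<forall>i<length vs. (vs ! i, vs ! (Suc i mod length vs)) \<in> adj G)"

definition is_tree :: "'a ugraph \<Rightarrow> bool" where
  "is_tree T \<longleftrightarrow> simple_graph T \<and> connected_graph T \<and> (\<nexists>vs. is_cycle T vs)"

definition is_spanning_tree :: "'a ugraph \<Rightarrow> 'a ugraph \<Rightarrow> bool" where
  "is_spanning_tree G T \<longleftrightarrow> is_tree T \<and> verts T = verts G \<and> edges T \<subseteq> edges G"

definition induced :: "'a ugraph \<Rightarrow> 'a set \<Rightarrow> 'a ugraph" where
  "induced G S = \<lparr>verts = S, edges = {e \<in> edges G. e \<subseteq> S}\<rparr>"

definition num_edges :: "'a ugraph \<Rightarrow> nat" where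
  "num_edges H = card (edges H)"

text \<open>Weights are total functions on vertex sets; only their values on \<^term>\<open>edges G\<close> matter.\<close>

definition weightings :: "'a ugraph \<Rightarrow> ('a set \<Rightarrow> real) set" where
  "weightings G = {\<omega>. (\<forall>e\<in>edges G. 0 \<le> \<omega> e) \<and> (\<exists>e\<in>edges G. \<omega> e \<noteq> 0)}"

definition weight :: "('a set \<Rightarrow> real) \<Rightarrow> 'a ugraph \<Rightarrow> real" where
  "weight \<omega> H = (\<Sum>e\<in>edges H. \<omega> e)"

definition is_max_spanning_tree :: "'a ugraph \<Rightarrow> ('a set \<Rightarrow> real) \<Rightarrow> 'a ugraph \<Rightarrow> bool" where
  "is_max_spanning_tree G \<omega> T \<longleftrightarrow> is_spanning_tree G T \<and>
     (\<forall>T'. is_spanning_tree G T' \<longrightarrow> weight \<omega> T' \<le> weight \<omega> T)"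

text \<open>All maximum spanning trees have the same weight, so the choice below does not affect the
  weighting ratio.\<close>

definition max_spanning_tree :: "'a ugraph \<Rightarrow> ('a set \<Rightarrow> real) \<Rightarrow> 'a ugraph" where
  "max_spanning_tree G \<omega> = (SOME T. is_max_spanning_tree G \<omega> T)"

definition weighting_ratio :: "'a ugraph \<Rightarrow> ('a set \<Rightarrow> real) \<Rightarrow> real" where
  "weighting_ratio G \<omega> = weight \<omega> (max_spanning_tree G \<omega>) / weight \<omega> G"

definition Co :: "'a ugraph \<Rightarrow> 'a set set" where
  "Co G = {S. S \<subseteq> verts G \<and> connected_graph (induced G S)}"

end

theory Submission
  imports Defs
begin

text \<open>For the upper bound, weight the edges inside \<open>S\<close> by 1 and all others by 0: a spanning tree
  restricted to \<open>S\<close> is a forest, hence has weight at most \<open>|S| - 1\<close>. For the lower bound, Kruskal's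
  algorithm yields a spanning tree \<open>B\<close> in which the endpoints of every edge \<open>e\<close> of \<open>G\<close> are joined
  by edges of weight at least \<open>\<omega> e\<close>. So for every threshold \<open>s\<close> the edges of \<open>B\<close> heavier than \<open>s\<close>
  span the components of the subgraph of all edges heavier than \<open>s\<close>; counting component by
  component, they number at least \<open>m\<close> times the edges of this subgraph, where \<open>m\<close> is the minimum
  over connected sets. Summation by parts over the thresholds gives \<open>\<omega> B \<ge> m \<sdot> \<omega> G\<close>.\<close>

section \<open>Edge sets as relations; forests and cycles\<close>

definition joins :: "'a set set \<Rightarrow> 'a rel" where
  "joins A = {(u, v). {u, v} \<in> A}"

text \<open>Acyclicity in the form that every edge is a bridge: it passes to subsets at once and can
  be maintained while a forest grows edge by edge. Lemmas below tie it to \<open>is_cycle\<close>.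
  Singleton edges are excluded too, by reflexivity of the closure.\<close>

definition forest :: "'a set set \<Rightarrow> bool" where
  "forest A \<longleftrightarrow> (\<forall>u v. {u, v} \<in> A \<longrightarrow> (u, v) \<notin> (joins (A - {{u, v}}))\<^sup>*)"

lemma adj_eq_joins: "adj G = joins (edges G)"
  by (simp add: adj_def joins_def)

lemma simple_graph_finite_edges: "simple_graph G \<Longrightarrow> finite (edges G)"
  unfolding simple_graph_def by (meson PowI finite_Pow_iff finite_subset subsetI)

lemma joins_mono: "A \<subseteq> B \<Longrightarrow> joins A \<subseteq> joins B"
  by (auto simp: joins_def)

lemma rtrancl_joins_mono: "(u, v) \<in> (joins A)\<^sup>* \<Longrightarrow> A \<subseteq> B \<Longrightarrow> (u, v) \<in> (joins B)\<^sup>*"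
  using rtrancl_mono[OF joins_mono] by blast

lemma sym_joins: "sym (joins A)"
  by (auto simp: sym_def joins_def insert_commute)

lemma rtrancl_joins_sym: "(u, v) \<in> (joins A)\<^sup>* \<Longrightarrow> (v, u) \<in> (joins A)\<^sup>*"
  using sym_joins sym_rtrancl symD by metis

text \<open>A walk that crosses the new edge several times can be cut short, so at most one crossing
  remains, in one of the two directions.\<close>

lemma rtrancl_joins_insertE:
  assumes "(x, y) \<in> (joins (insert {u, v} A))\<^sup>*"
  shows "(x, y) \<in> (joins A)\<^sup>* \<or> (x, u) \<in> (joins A)\<^sup>* \<and> (v, y) \<in> (joins A)\<^sup>*
    \<or> (x, v) \<in> (joins A)\<^sup>* \<and> (u, y) \<in> (joins A)\<^sup>*"
  using assms
proof (induction rule: rtrancl_induct)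
  case base
  then show ?case by simp
next
  case (step y z)
  have "(y, z) \<in> joins A \<or> y = u \<and> z = v \<or> y = v \<and> z = u"
    using step.hyps(2) by (auto simp: joins_def doubleton_eq_iff)
  with step.IH show ?case
    by (meson rtrancl.rtrancl_into_rtrancl rtrancl.rtrancl_refl)
qed

lemma rtrancl_leaves_set:
  assumes "(x, y) \<in> r\<^sup>*" "x \<in> C" "y \<notin> C"
  obtains a b where "(a, b) \<in> r" "a \<in> C" "b \<notin> C"
  using assms by (induction rule: rtrancl_induct) auto

lemma forest_mono: "forest A \<Longrightarrow> B \<subseteq> A \<Longrightarrow> forest B"
  unfolding forest_def by (blast intro: rtrancl_joins_mono[OF _ Diff_mono])

text \<open>If another edge \<open>{x, y}\<close> failed to be a bridge, the walk around it would
  have to cross \<open>{u, v}\<close>. Its two pieces together with \<open>{x, y}\<close> would then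
  join \<open>u\<close> to \<open>v\<close> inside \<open>A\<close>.\<close>

lemma forest_insert:
  assumes A: "forest A" and uv: "(u, v) \<notin> (joins A)\<^sup>*"
  shows "forest (insert {u, v} A)"
  unfolding forest_def
proof (intro allI impI notI)
  fix x y assume xy: "{x, y} \<in> insert {u, v} A"
    and con: "(x, y) \<in> (joins (insert {u, v} A - {{x, y}}))\<^sup>*"
  have notin: "{u, v} \<notin> A"
    using uv by (auto simp: joins_def)
  show False
  proof (cases "{x, y} = {u, v}")
    case True
    then have "(x, y) \<in> (joins A)\<^sup>*"
      using con notin by (simp add: insert_Diff_if)
    then show False
      using True uv rtrancl_joins_sym by (metis doubleton_eq_iff)
  next
    case False
    then have xyA: "{x, y} \<in> A" using xy by simp
    let ?J = "(joins (A - {{x, y}}))\<^sup>*"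
    have "(x, y) \<in> (joins (insert {u, v} (A - {{x, y}})))\<^sup>*"
      using con False by (simp add: insert_Diff_if)
    then have "(x, y) \<in> ?J \<or> (x, u) \<in> ?J \<and> (v, y) \<in> ?J \<or> (x, v) \<in> ?J \<and> (u, y) \<in> ?J"
      by (rule rtrancl_joins_insertE)
    moreover have "(x, y) \<notin> ?J"
      using A xyA by (auto simp: forest_def)
    moreover have sub: "(a, b) \<in> (joins A)\<^sup>*" if "(a, b) \<in> ?J" for a b
      using that by (rule rtrancl_joins_mono) auto
    moreover have "(x, y) \<in> (joins A)\<^sup>*" "(y, x) \<in> (joins A)\<^sup>*"
      using xyA by (auto simp: joins_def insert_commute)
    ultimately show False
      using uv by (meson rtrancl_joins_sym rtrancl_trans)
  qed
qed

lemma rtrancl_imp_distinct_path: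
  assumes "(u, v) \<in> r\<^sup>*"
  shows "\<exists>vs. vs \<noteq> [] \<and> distinct vs \<and> hd vs = u \<and> last vs = v \<and> successively (\<lambda>x y. (x, y) \<in> r) vs"
  using assms
proof (induction rule: converse_rtrancl_induct)
  case base
  show ?case by (rule exI[of _ "[v]"]) simp
next
  case (step x y)
  then obtain vs where vs: "vs \<noteq> []" "distinct vs" "hd vs = y" "last vs = v"
    "successively (\<lambda>x y. (x, y) \<in> r) vs" by blast
  show ?case
  proof (cases "x \<in> set vs")
    case True
    \<comment> \<open>If \<open>x\<close> already lies on the path, the suffix starting there is
      still distinct and ends in \<open>v\<close>.\<close>
    then obtain as bs where "vs = as @ x # bs" by (meson split_list)
    with vs show ?thesis
      by (intro exI[of _ "x # bs"]) (auto simp: successively_append_iff)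
  next
    case False
    with vs step.hyps show ?thesis
      by (intro exI[of _ "x # vs"]) (auto simp: successively_Cons)
  qed
qed

text \<open>A path from \<open>u\<close> to \<open>v\<close> that avoids the edge between them is
  closed by that edge into a cycle.\<close>

lemma acyclic_imp_forest:
  assumes simple: "simple_graph G" and "\<nexists>vs. is_cycle G vs"
  shows "forest (edges G)"
  unfolding forest_def
proof (intro allI impI notI)
  fix u v assume e: "{u, v} \<in> edges G" and con: "(u, v) \<in> (joins (edges G - {{u, v}}))\<^sup>*"
  have "u \<noteq> v"
    using simple e unfolding simple_graph_def by force
  obtain vs where vs: "vs \<noteq> []" "distinct vs" "hd vs = u" "last vs = v"
    and suc: "successively (\<lambda>x y. (x, y) \<in> joins (edges G - {{u, v}})) vs"
    using rtrancl_imp_distinct_path[OF con] by blast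
  have step: "(vs ! i, vs ! Suc i) \<in> joins (edges G - {{u, v}})" if "Suc i < length vs" for i
    using suc that by (simp add: successively_conv_nth)
  have ends: "vs ! 0 = u" "vs ! (length vs - 1) = v"
    using vs by (simp_all add: hd_conv_nth last_conv_nth)
  \<comment> \<open>One vertex would force \<open>u = v\<close>; two would make the deleted edge the
    only step of the path.\<close>
  have "length vs \<noteq> 1"
    using ends \<open>u \<noteq> v\<close> by auto
  moreover have "length vs \<noteq> 2"
  proof
    assume "length vs = 2"
    with step[of 0] ends show False by (simp add: joins_def numeral_2_eq_2)
  qed
  ultimately have len: "3 \<le> length vs"
    using vs(1) by (cases "length vs") auto
  have "(vs ! i, vs ! (Suc i mod length vs)) \<in> adj G" if i: "i < length vs" for i
  proof (cases "Suc i = length vs")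
    case True
    then have "i = length vs - 1" by simp
    with True ends e show ?thesis by (simp add: adj_def insert_commute)
  next
    case False
    with i step[of i] show ?thesis by (simp add: adj_def joins_def)
  qed
  with len vs(2) have "is_cycle G vs" by (simp add: is_cycle_def)
  with assms(2) show False by blast
qed

text \<open>The edge from the last vertex back to the first is no bridge, since the rest of the
  cycle joins its ends.\<close>

lemma forest_imp_acyclic:
  assumes "forest (edges G)"
  shows "\<not> is_cycle G vs"
proof
  assume cyc: "is_cycle G vs"
  define n where "n = length vs"
  have n: "3 \<le> n" and dist: "distinct vs"
    and adj: "\<And>i. i < n \<Longrightarrow> {vs ! i, vs ! (Suc i mod n)} \<in> edges G"
    using cyc by (auto simp: is_cycle_def adj_def n_def)
  have idx: "vs ! i = vs ! j \<longleftrightarrow> i = j" if "i < n" "j < n" for i j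
    using that dist by (simp add: nth_eq_iff_index_eq n_def)
  let ?e = "{vs ! 0, vs ! (n - 1)}"
  have e: "?e \<in> edges G"
    using adj[of "n - 1"] n by (simp add: insert_commute)
  have "(vs ! 0, vs ! i) \<in> (joins (edges G - {?e}))\<^sup>*" if "i < n" for i
    using that
  proof (induction i)
    case 0
    then show ?case by simp
  next
    case (Suc i)
    have "{vs ! i, vs ! Suc i} \<in> edges G"
      using adj[of i] Suc.prems by simp
    \<comment> \<open>A step of the cycle could equal the closing edge only for
      \<open>n = 2\<close>.\<close>
    moreover have "{vs ! i, vs ! Suc i} \<noteq> ?e"
      using idx[of i 0] idx[of "Suc i" 0] idx[of "Suc i" "n - 1"] Suc.prems n
      by (simp add: doubleton_eq_iff) linarith
    ultimately have "(vs ! i, vs ! Suc i) \<in> joins (edges G - {?e})"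
      by (simp add: joins_def)
    with Suc show ?case by (meson Suc_lessD rtrancl.rtrancl_into_rtrancl)
  qed
  from this[of "n - 1"] e n assms show False
    by (auto simp: forest_def)
qed

section \<open>Edge counts of forests and of connecting edge sets\<close>

text \<open>Deleting an edge \<open>{u, v}\<close> separates its ends, so \<open>S\<close> splits
  into the component of \<open>u\<close> and a nonempty rest, with no remaining edge between them.
  The two strict bounds from the induction leave room for the deleted edge.\<close>

lemma forest_card_less:
  assumes "finite S" "S \<noteq> {}" "forest A" "\<forall>e\<in>A. e \<subseteq> S \<and> card e = 2"
  shows "card A < card S"
  using assms
proof (induction "card S" arbitrary: S A rule: less_induct)
  case less
  show ?case
  proof (cases "A = {}")
    case True
    with less.prems show ?thesis by (simp add: card_gt_0_iff)
  next
    case False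
    then obtain u v where e: "{u, v} \<in> A"
      using less.prems(4) by (metis all_not_in_conv card_2_iff)
    let ?A = "A - {{u, v}}"
    define C where "C = {x \<in> S. (u, x) \<in> (joins ?A)\<^sup>*}"
    have finA: "finite A"
      using less.prems(1,4) by (meson PowI finite_Pow_iff finite_subset subsetI)
    have u: "u \<in> C" and v: "v \<in> S - C"
      using e less.prems(3,4) by (auto simp: C_def forest_def)
    have CS: "C \<subseteq> S" by (auto simp: C_def)
    have split: "e \<subseteq> C \<or> e \<subseteq> S - C" if eA: "e \<in> ?A" for e
    proof -
      obtain a b where ab: "e = {a, b}" "a \<in> S" "b \<in> S"
        using eA less.prems(4) by (metis DiffD1 card_2_iff insert_subset)
      have "(a, b) \<in> joins ?A" "(b, a) \<in> joins ?A"
        using eA ab(1) by (auto simp: joins_def insert_commute)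
      then have "a \<in> C \<longleftrightarrow> b \<in> C"
        using ab by (auto simp: C_def intro: rtrancl.rtrancl_into_rtrancl)
      with ab show ?thesis by auto
    qed
    have "C \<subset> S" "S - C \<subset> S" using u v CS by auto
    then have cards: "card C < card S" "card (S - C) < card S"
      using less.prems(1) by (auto intro: psubset_card_mono)
    have fin: "finite C" "finite (S - C)"
      using less.prems(1) CS finite_subset by auto
    have 1: "card {e \<in> ?A. e \<subseteq> C} < card C"
    proof (rule less.hyps[OF cards(1) fin(1)])
      show "forest {e \<in> ?A. e \<subseteq> C}" by (rule forest_mono[OF less.prems(3)]) auto
    qed (use u less.prems(4) in auto)
    have 2: "card {e \<in> ?A. e \<subseteq> S - C} < card (S - C)"
    proof (rule less.hyps[OF cards(2) fin(2)])
      show "forest {e \<in> ?A. e \<subseteq> S - C}" by (rule forest_mono[OF less.prems(3)]) auto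
    qed (use v less.prems(4) in auto)
    have "card ?A \<le> card {e \<in> ?A. e \<subseteq> C} + card {e \<in> ?A. e \<subseteq> S - C}"
      using split finA
      by (intro order_trans[OF card_mono card_Un_le]) auto
    moreover have "card S = card C + card (S - C)"
      using CS less.prems(1) by (simp add: card_Diff_subset finite_subset card_mono)
    moreover have "card A = Suc (card ?A)"
      using e finA by (metis card_Suc_Diff1)
    ultimately show ?thesis using 1 2 by linarith
  qed
qed

text \<open>A set grown from one vertex along edges that leave it gains at least one inner edge with
  each new vertex.\<close>

lemma card_le_Suc_connecting_edges:
  assumes S: "finite S" and A: "finite A" and con: "\<forall>u\<in>S. \<forall>v\<in>S. (u, v) \<in> (joins A)\<^sup>*"
    and sub: "\<forall>e\<in>A. e \<subseteq> S"
  shows "card S \<le> Suc (card A)"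
proof (cases "S = {}")
  case False
  have "\<exists>C\<subseteq>S. card C = Suc k \<and> k \<le> card {e \<in> A. e \<subseteq> C}" if "k < card S" for k
    using that
  proof (induction k)
    case 0
    from False obtain x where "x \<in> S" by blast
    then show ?case by (intro exI[of _ "{x}"]) auto
  next
    case (Suc k)
    then obtain C where C: "C \<subseteq> S" "card C = Suc k" "k \<le> card {e \<in> A. e \<subseteq> C}" by auto
    have "C \<noteq> {}" using C(2) by auto
    moreover have "C \<noteq> S" using C(2) Suc.prems by auto
    ultimately obtain x y where "x \<in> C" "y \<in> S - C" using C(1) by blast
    with con C(1) have "(x, y) \<in> (joins A)\<^sup>*" by blast
    then obtain a b where ab: "(a, b) \<in> joins A" "a \<in> C" "b \<notin> C"
      using \<open>x \<in> C\<close> \<open>y \<in> S - C\<close> by (blast elim: rtrancl_leaves_set)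
    then have abA: "{a, b} \<in> A" by (simp add: joins_def)
    \<comment> \<open>The edge \<open>{a, b}\<close> was not inside \<open>C\<close>, because
      \<open>b\<close> is not in \<open>C\<close>; hence it counts as new.\<close>
    have "insert {a, b} {e \<in> A. e \<subseteq> C} \<subseteq> {e \<in> A. e \<subseteq> insert b C}"
      using abA ab by auto
    then have "card (insert {a, b} {e \<in> A. e \<subseteq> C}) \<le> card {e \<in> A. e \<subseteq> insert b C}"
      using A by (intro card_mono) auto
    moreover have "card (insert {a, b} {e \<in> A. e \<subseteq> C}) = Suc (card {e \<in> A. e \<subseteq> C})"
      using A ab(3) by (intro card_insert_disjoint) auto
    moreover have "card (insert b C) = Suc (Suc k)"
      using C ab(3) S finite_subset by (metis card_insert_disjoint)
    moreover have "insert b C \<subseteq> S" using sub abA C(1) by auto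
    ultimately show ?case using C(3) by (intro exI[of _ "insert b C"]) auto
  qed
  from this[of "card S - 1"] False S obtain C where
    "card S - 1 \<le> card {e \<in> A. e \<subseteq> C}" by (auto simp: card_gt_0_iff)
  also have "\<dots> \<le> card A" using A by (intro card_mono) auto
  finally show ?thesis by simp
qed simp

section \<open>Greedy forests and summation by parts\<close>

text \<open>Kruskal's algorithm as an induction: ranking by negated weight makes the heaviest edges
  come first, and an edge is kept iff its ends are not yet joined.\<close>

lemma exists_greedy_forest:
  fixes \<omega> :: "'a set \<Rightarrow> real"
  assumes "finite F" "\<forall>e\<in>F. card e = 2"
  shows "\<exists>B\<subseteq>F. forest B \<and> (\<forall>u v. {u, v} \<in> F \<longrightarrow> (u, v) \<in> (joins {b \<in> B. \<omega> {u, v} \<le> \<omega> b})\<^sup>*)"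
  using assms
proof (induction rule: finite_ranking_induct[where f = "\<lambda>e. - \<omega> e"])
  case empty
  show ?case by (simp add: forest_def)
next
  case (insert e F)
  then obtain B where B: "B \<subseteq> F" "forest B"
    "\<And>u v. {u, v} \<in> F \<Longrightarrow> (u, v) \<in> (joins {b \<in> B. \<omega> {u, v} \<le> \<omega> b})\<^sup>*" by auto
  \<comment> \<open>The edge \<open>e\<close> is a lightest one so far, so its threshold removes
    nothing from \<open>B\<close>.\<close>
  have least: "{b \<in> B. \<omega> e \<le> \<omega> b} = B" using insert.hyps(2) B(1) by auto
  obtain u v where e: "e = {u, v}" using insert.prems by (metis card_2_iff insertI1)
  show ?case
  proof (cases "(u, v) \<in> (joins B)\<^sup>*")
    case True
    have "(x, y) \<in> (joins {b \<in> B. \<omega> {x, y} \<le> \<omega> b})\<^sup>*" if xy: "{x, y} \<in> insert e F" for x y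
    proof (cases "{x, y} = e")
      case eq: True
      then have "(x, y) \<in> (joins B)\<^sup>*"
        using e True rtrancl_joins_sym by (metis doubleton_eq_iff)
      with eq least show ?thesis by simp
    qed (use xy B(3) in auto)
    with B show ?thesis by (intro exI[of _ B]) auto
  next
    case False
    let ?B = "insert e B"
    have "(x, y) \<in> (joins {b \<in> ?B. \<omega> {x, y} \<le> \<omega> b})\<^sup>*" if xy: "{x, y} \<in> insert e F" for x y
    proof (cases "{x, y} = e")
      case True
      then show ?thesis by (intro r_into_rtrancl) (simp add: joins_def)
    next
      case False
      with xy B(3) have "(x, y) \<in> (joins {b \<in> B. \<omega> {x, y} \<le> \<omega> b})\<^sup>*" by simp
      then show ?thesis by (rule rtrancl_joins_mono) auto
    qed
    with B forest_insert[OF B(2) False] e show ?thesis by (intro exI[of _ ?B]) auto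
  qed
qed

text \<open>The sum is a combination of upper sums whose coefficients are the nonnegative gaps
  between consecutive weights. The bound \<open>t\<close> stays arbitrary so that the induction can
  raise it to the minimum \<open>w\<close> once the lightest elements are removed.\<close>

lemma sum_mult_nonneg_of_upper_sums_nonneg:
  fixes \<omega> c :: "'b \<Rightarrow> real"
  assumes "finite A" "\<And>s. 0 \<le> (\<Sum>e | e \<in> A \<and> s < \<omega> e. c e)" "\<And>e. e \<in> A \<Longrightarrow> t \<le> \<omega> e"
  shows "0 \<le> (\<Sum>e\<in>A. c e * (\<omega> e - t))"
  using assms
proof (induction "card A" arbitrary: A t rule: less_induct)
  case less
  show ?case
  proof (cases "A = {}")
    case False
    define w where "w = Min (\<omega> ` A)"
    let ?A = "{e \<in> A. w < \<omega> e}"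
    have w_le: "w \<le> \<omega> e" if "e \<in> A" for e
      using that less.prems(1) by (simp add: w_def)
    have "w \<in> \<omega> ` A" unfolding w_def using less.prems(1) False by (intro Min_in) auto
    then obtain a where a: "a \<in> A" "\<omega> a = w" by blast
    then have "?A \<subset> A" by auto
    then have "card ?A < card A" using less.prems(1) by (rule psubset_card_mono[rotated])
    \<comment> \<open>Upper sums of \<open>?A\<close> are the upper sums of \<open>A\<close> with
      threshold at least \<open>w\<close>.\<close>
    moreover have "0 \<le> (\<Sum>e | e \<in> ?A \<and> s < \<omega> e. c e)" for s
      using less.prems(2)[of "max s w"] by (simp add: conj_ac)
    ultimately have "0 \<le> (\<Sum>e\<in>?A. c e * (\<omega> e - w))"
      using less.prems(1) by (intro less.hyps) auto
    also have "\<dots> = (\<Sum>e\<in>A. c e * (\<omega> e - w))"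
      using less.prems(1) w_le by (intro sum.mono_neutral_left) force+
    finally have 1: "0 \<le> (\<Sum>e\<in>A. c e * (\<omega> e - w))" .
    \<comment> \<open>A threshold strictly below the minimum captures all of \<open>A\<close>, so
      the full sum of \<open>c\<close> is an upper sum as well.\<close>
    have "{e. e \<in> A \<and> w - 1 < \<omega> e} = A" using w_le by force
    with less.prems(2)[of "w - 1"] have "0 \<le> sum c A" by simp
    moreover have "t \<le> w" using less.prems(3) a by blast
    ultimately have 2: "0 \<le> (w - t) * sum c A" by simp
    have "(\<Sum>e\<in>A. c e * (\<omega> e - t)) = (\<Sum>e\<in>A. c e * (\<omega> e - w)) + (w - t) * sum c A"
      by (simp add: sum_distrib_left flip: sum.distrib) (simp add: algebra_simps)
    with 1 2 show ?thesis by simp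
  qed simp
qed

text \<open>Used to see that a component of \<open>B\<close> is connected by the edges of
  \<open>B\<close> lying inside it.\<close>

lemma rtrancl_joins_in_class:
  assumes "(u, v) \<in> (joins B)\<^sup>*" "u \<in> C" "\<And>a b. a \<in> C \<Longrightarrow> (a, b) \<in> joins B \<Longrightarrow> b \<in> C"
  shows "v \<in> C \<and> (u, v) \<in> (joins {e \<in> B. e \<subseteq> C})\<^sup>*"
  using assms(1)
proof (induction rule: rtrancl_induct)
  case base
  with assms(2) show ?case by simp
next
  case (step y z)
  then have "(y, z) \<in> joins {e \<in> B. e \<subseteq> C}" "z \<in> C"
    using assms(3) by (auto simp: joins_def)
  with step.IH show ?case by (meson rtrancl.rtrancl_into_rtrancl)
qed

section \<open>Counting by components; heavy spanning trees\<close>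

text \<open>On a component \<open>C\<close> of \<open>B\<close> there are at least
  \<open>card C - 1\<close> edges of \<open>B\<close>, hence at least \<open>m\<close> times the
  number of edges of \<open>G\<close> inside \<open>C\<close>. By \<open>con\<close> every edge of
  \<open>F\<close> lies inside some component, so summing over the components suffices.\<close>

lemma card_connecting_edges_ge:
  fixes m :: real
  assumes G: "simple_graph G" and "B \<subseteq> F" "F \<subseteq> edges G"
    and con: "\<And>u v. {u, v} \<in> F \<Longrightarrow> (u, v) \<in> (joins B)\<^sup>*"
    and m0: "0 \<le> m"
    and m: "\<And>S. S \<in> Co G \<Longrightarrow> 2 \<le> card S \<Longrightarrow> m * num_edges (induced G S) \<le> real (card S) - 1"
  shows "m * card F \<le> card B"
proof -
  have finV: "finite (verts G)" and edge: "\<And>e. e \<in> edges G \<Longrightarrow> e \<subseteq> verts G \<and> card e = 2"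
    using G by (auto simp: simple_graph_def)
  have finE: "finite (edges G)"
    using G by (rule simple_graph_finite_edges)
  have finB: "finite B" using finE assms(2,3) by (meson finite_subset)
  \<comment> \<open>Vertices isolated in \<open>B\<close> form singleton classes, so the classes
    partition all of \<open>verts G\<close>.\<close>
  define cls where "cls u = {x \<in> verts G. (u, x) \<in> (joins B)\<^sup>*}" for u
  define Q where "Q = cls ` verts G"
  have finQ: "finite Q" using finV by (simp add: Q_def)
  have finC: "finite C" if "C \<in> Q" for C using that finV by (auto simp: Q_def cls_def)
  have cls_eq: "cls u = cls v" if "(u, v) \<in> (joins B)\<^sup>*" for u v
    using that rtrancl_joins_sym[OF that] by (auto simp: cls_def intro: rtrancl_trans)
  have disj: "C \<inter> D = {}" if "C \<in> Q" "D \<in> Q" "C \<noteq> D" for C D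
  proof (rule ccontr)
    assume "C \<inter> D \<noteq> {}"
    then obtain x where x: "x \<in> C" "x \<in> D" by blast
    obtain c d where "C = cls c" "D = cls d" using \<open>C \<in> Q\<close> \<open>D \<in> Q\<close> by (auto simp: Q_def)
    with x have "C = cls x" "D = cls x" using cls_eq by (auto simp: cls_def)
    with \<open>C \<noteq> D\<close> show False by simp
  qed
  have per_class: "m * card {e \<in> edges G. e \<subseteq> C} \<le> card {e \<in> B. e \<subseteq> C}" if C: "C \<in> Q" for C
  proof -
    obtain c where c: "c \<in> verts G" "C = cls c" using C by (auto simp: Q_def)
    have closed: "b \<in> C" if "a \<in> C" "(a, b) \<in> joins B" for a b
    proof -
      have "b \<in> verts G" using that(2) assms(2,3) edge by (fastforce simp: joins_def)
      with that c(2) show ?thesis by (auto simp: cls_def intro: rtrancl.rtrancl_into_rtrancl)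
    qed
    have CB: "(u, v) \<in> (joins {e \<in> B. e \<subseteq> C})\<^sup>*" if "u \<in> C" "v \<in> C" for u v
    proof -
      have "(u, c) \<in> (joins B)\<^sup>*" "(c, v) \<in> (joins B)\<^sup>*"
        using that c(2) rtrancl_joins_sym by (auto simp: cls_def)
      then have "(u, v) \<in> (joins B)\<^sup>*" by (rule rtrancl_trans)
      then have "v \<in> C \<and> ?thesis"
        using that(1) by (rule rtrancl_joins_in_class) (rule closed)
      then show ?thesis ..
    qed
    have cC: "c \<in> C" using c by (simp add: cls_def)
    have CV: "C \<subseteq> verts G" using c(2) by (auto simp: cls_def)
    have *: "card C \<le> Suc (card {e \<in> B. e \<subseteq> C})"
      using finB finC[OF C] CB by (intro card_le_Suc_connecting_edges) auto
    show ?thesis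
    proof (cases "2 \<le> card C")
      case True
      have "(u, v) \<in> (joins {e \<in> edges G. e \<subseteq> C})\<^sup>*" if "u \<in> C" "v \<in> C" for u v
        using CB[OF that] by (rule rtrancl_joins_mono) (use assms(2,3) in auto)
      then have "C \<in> Co G"
        using CV cC by (auto simp: Co_def connected_graph_def induced_def adj_eq_joins)
      from m[OF this True] * show ?thesis by (simp add: num_edges_def induced_def)
    next
      case False
      \<comment> \<open>A single vertex spans no edge, which settles the classes that
        \<open>m\<close> does not speak about.\<close>
      then have "\<not> e \<subseteq> C" if "e \<in> edges G" for e
        using edge[OF that] card_mono[OF finC[OF C], of e] by auto
      then have "card {e \<in> edges G. e \<subseteq> C} = 0" by (simp add: card_eq_0_iff)
      then show ?thesis by simp
    qed
  qed
  have "F \<subseteq> (\<Union>C\<in>Q. {e \<in> edges G. e \<subseteq> C})"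
  proof
    fix e assume e: "e \<in> F"
    then have eG: "e \<in> edges G" using assms(3) by blast
    then obtain u v where uv: "e = {u, v}" using edge by (metis card_2_iff)
    then have "e \<subseteq> cls u" using con e edge[OF eG] by (auto simp: cls_def)
    moreover have "cls u \<in> Q" using uv edge[OF eG] by (auto simp: Q_def)
    ultimately show "e \<in> (\<Union>C\<in>Q. {e \<in> edges G. e \<subseteq> C})" using eG by blast
  qed
  then have "card F \<le> card (\<Union>C\<in>Q. {e \<in> edges G. e \<subseteq> C})"
    using finQ finE by (intro card_mono) auto
  also have "\<dots> \<le> (\<Sum>C\<in>Q. card {e \<in> edges G. e \<subseteq> C})"
    using finQ by (rule card_UN_le)
  finally have "m * card F \<le> m * real (\<Sum>C\<in>Q. card {e \<in> edges G. e \<subseteq> C})"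
    using m0 by (intro mult_left_mono of_nat_mono)
  also have "\<dots> = (\<Sum>C\<in>Q. m * card {e \<in> edges G. e \<subseteq> C})"
    by (simp add: sum_distrib_left)
  also have "\<dots> \<le> (\<Sum>C\<in>Q. real (card {e \<in> B. e \<subseteq> C}))"
    using per_class by (rule sum_mono)
  also have "\<dots> = real (card (\<Union>C\<in>Q. {e \<in> B. e \<subseteq> C}))"
  proof (subst card_UN_disjoint)
    show "\<forall>C\<in>Q. \<forall>D\<in>Q. C \<noteq> D \<longrightarrow> {e \<in> B. e \<subseteq> C} \<inter> {e \<in> B. e \<subseteq> D} = {}"
    proof (intro ballI impI)
      fix C D assume CD: "C \<in> Q" "D \<in> Q" "C \<noteq> D"
      \<comment> \<open>An empty edge would lie inside two disjoint classes at once.\<close>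
      have "e \<noteq> {}" if "e \<in> B" for e using that assms(2,3) edge[of e] by auto
      then show "{e \<in> B. e \<subseteq> C} \<inter> {e \<in> B. e \<subseteq> D} = {}" using disj[OF CD] by blast
    qed
  qed (use finQ finB in auto)
  also have "\<dots> \<le> card B"
    using finB by (intro of_nat_mono card_mono) auto
  finally show ?thesis .
qed

lemma exists_heavy_spanning_tree:
  fixes m :: real
  assumes G: "simple_graph G" "connected_graph G" and \<omega>: "\<forall>e\<in>edges G. 0 \<le> \<omega> e" and m0: "0 \<le> m"
    and m: "\<And>S. S \<in> Co G \<Longrightarrow> 2 \<le> card S \<Longrightarrow> m * num_edges (induced G S) \<le> real (card S) - 1"
  shows "\<exists>T. is_spanning_tree G T \<and> m * weight \<omega> G \<le> weight \<omega> T"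
proof -
  have finE: "finite (edges G)" using G(1) by (rule simple_graph_finite_edges)
  obtain B where B: "B \<subseteq> edges G" "forest B"
    and con: "\<And>u v. {u, v} \<in> edges G \<Longrightarrow> (u, v) \<in> (joins {b \<in> B. \<omega> {u, v} \<le> \<omega> b})\<^sup>*"
    using exists_greedy_forest[OF finE, of \<omega>] G(1) by (auto simp: simple_graph_def)
  let ?T = "\<lparr>verts = verts G, edges = B\<rparr>"
  have "joins (edges G) \<subseteq> (joins B)\<^sup>*"
  proof (clarsimp simp: joins_def[of "edges G"])
    fix u v assume "{u, v} \<in> edges G"
    from con[OF this] show "(u, v) \<in> (joins B)\<^sup>*" by (rule rtrancl_joins_mono) auto
  qed
  then have "(joins (edges G))\<^sup>* \<subseteq> (joins B)\<^sup>*" by (rule rtrancl_subset_rtrancl)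
  then have "connected_graph ?T"
    using G(2) unfolding connected_graph_def adj_eq_joins by auto
  moreover have "simple_graph ?T" using G(1) B(1) by (auto simp: simple_graph_def)
  moreover have "\<not> is_cycle ?T vs" for vs using B(2) by (intro forest_imp_acyclic) simp
  ultimately have tree: "is_spanning_tree G ?T"
    using B(1) by (simp add: is_spanning_tree_def is_tree_def)
  \<comment> \<open>With these coefficients the sum of \<open>c e * \<omega> e\<close> is
    \<open>weight \<omega> ?T - m * weight \<omega> G\<close>, and an upper sum of \<open>c\<close>
    is the difference of the two sides of the counting inequality.\<close>
  define c where "c e = of_bool (e \<in> B) - m" for e
  have upper: "0 \<le> (\<Sum>e | e \<in> edges G \<and> s < \<omega> e. c e)" for s
  proof -
    let ?F = "{e. e \<in> edges G \<and> s < \<omega> e}" and ?B = "{e \<in> B. s < \<omega> e}"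
    have "m * card ?F \<le> card ?B"
    proof (rule card_connecting_edges_ge[OF G(1) _ _ _ m0 m])
      fix u v assume uv: "{u, v} \<in> ?F"
      \<comment> \<open>The joining edges are at least as heavy as \<open>{u, v}\<close>, hence also
        above the threshold \<open>s\<close>.\<close>
      then have "(u, v) \<in> (joins {b \<in> B. \<omega> {u, v} \<le> \<omega> b})\<^sup>*" using con by simp
      then show "(u, v) \<in> (joins ?B)\<^sup>*" by (rule rtrancl_joins_mono) (use uv in auto)
    qed (use B(1) in auto)
    moreover have "(\<Sum>e\<in>?F. of_bool (e \<in> B)) = real (card ?B)"
    proof -
      have "?F \<inter> {e. e \<in> B} = ?B" using B(1) by auto
      then show ?thesis using finE by (simp add: sum_of_bool_eq)
    qed
    ultimately show ?thesis by (simp add: c_def sum_subtractf mult.commute)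
  qed
  have "0 \<le> (\<Sum>e\<in>edges G. c e * (\<omega> e - 0))"
    using sum_mult_nonneg_of_upper_sums_nonneg[OF finE upper] \<omega> by blast
  also have "\<dots> = (\<Sum>e\<in>edges G. of_bool (e \<in> B) * \<omega> e) - m * weight \<omega> G"
    by (simp add: c_def weight_def sum_distrib_left left_diff_distrib sum_subtractf)
  also have "(\<Sum>e\<in>edges G. of_bool (e \<in> B) * \<omega> e) = weight \<omega> ?T"
    unfolding weight_def using finE B(1) by (intro sum.mono_neutral_cong_right) auto
  finally show ?thesis using tree by (intro exI[of _ ?T]) simp
qed

section \<open>Maximum spanning trees and the two bounds\<close>

text \<open>Justifies the choice in \<open>max_spanning_tree\<close>: spanning trees exist and
  attain only finitely many weights.\<close>

lemma is_max_spanning_tree_max_spanning_tree: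
  assumes "simple_graph G" "connected_graph G"
  shows "is_max_spanning_tree G \<omega> (max_spanning_tree G \<omega>)"
proof -
  let ?W = "weight \<omega> ` {T. is_spanning_tree G T}"
  have "?W \<subseteq> sum \<omega> ` Pow (edges G)"
    by (auto simp: is_spanning_tree_def weight_def)
  then have fin: "finite ?W"
    using simple_graph_finite_edges[OF assms(1)] by (simp add: finite_subset)
  \<comment> \<open>For \<open>m = 0\<close> the bound on connected sets is trivial, which leaves
    the bare existence of a spanning tree.\<close>
  have "?W \<noteq> {}"
    using exists_heavy_spanning_tree[OF assms, of "\<lambda>_. 0" 0] by fastforce
  with fin have "Max ?W \<in> ?W" by (rule Max_in)
  then obtain T where "is_spanning_tree G T" "weight \<omega> T = Max ?W" by auto
  with fin have "is_max_spanning_tree G \<omega> T" by (simp add: is_max_spanning_tree_def)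
  then show ?thesis unfolding max_spanning_tree_def by (rule someI)
qed

text \<open>Allows clearing the denominators of the quotients, and later shows that the extremal
  weighting is not identically zero.\<close>

lemma induced_edges_pos:
  assumes "simple_graph G" "S \<in> Co G" "2 \<le> card S"
  shows "0 < num_edges (induced G S)"
proof -
  have "finite S" using assms(3) card.infinite by fastforce
  then have "card S \<le> Suc (card (edges (induced G S)))"
    using assms(2) simple_graph_finite_edges[OF assms(1)]
    by (intro card_le_Suc_connecting_edges)
      (auto simp: Co_def connected_graph_def adj_eq_joins induced_def)
  with assms(3) show ?thesis by (simp add: num_edges_def)
qed

theorem theorem3:
  fixes G :: "'a ugraph"
  assumes "simple_graph G" and "connected_graph G" and "edges G \<noteq> {}"
  shows "(INF \<omega>\<in>weightings G. weighting_ratio G \<omega>) =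
    Min ((\<lambda>S. (real (card S) - 1) / real (num_edges (induced G S))) ` {S \<in> Co G. 2 \<le> card S})"
proof -
  let ?q = "\<lambda>S. (real (card S) - 1) / real (num_edges (induced G S))"
  let ?C = "{S \<in> Co G. 2 \<le> card S}"
  define m where "m = Min (?q ` ?C)"
  have finE: "finite (edges G)" using assms(1) by (rule simple_graph_finite_edges)
  have finV: "finite (verts G)" using assms(1) by (simp add: simple_graph_def)
  have "finite ?C" using finV by (rule finite_subset[rotated, OF finite_Pow_iff[THEN iffD2]]) (auto simp: Co_def)
  then have finC: "finite (?q ` ?C)" by simp
  \<comment> \<open>The whole vertex set is a candidate, so \<open>Min\<close> is taken over a
    nonempty set.\<close>
  have "{e \<in> edges G. e \<subseteq> verts G} = edges G" using assms(1) by (auto simp: simple_graph_def)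
  then have "induced G (verts G) = \<lparr>verts = verts G, edges = edges G\<rparr>" by (simp add: induced_def)
  then have "verts G \<in> Co G"
    using assms(2) by (simp add: Co_def connected_graph_def adj_eq_joins)
  moreover obtain e where "e \<in> edges G" using assms(3) by blast
  then have "2 \<le> card (verts G)"
    using assms(1) card_mono[OF finV, of e] by (auto simp: simple_graph_def)
  ultimately have ne: "?q ` ?C \<noteq> {}" by blast
  have m_in: "m \<in> ?q ` ?C" unfolding m_def using finC ne by (rule Min_in)
  then obtain S where S: "S \<in> Co G" "2 \<le> card S" "m = ?q S" by blast
  have m0: "0 \<le> m" using S(2,3) by simp
  have m: "m * num_edges (induced G S) \<le> real (card S) - 1" if "S \<in> Co G" "2 \<le> card S" for S
  proof -
    have "m \<le> ?q S" unfolding m_def using finC that by (intro Min_le) auto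
    with induced_edges_pos[OF assms(1) that] show ?thesis by (simp add: field_simps)
  qed
  have lower: "m \<le> weighting_ratio G \<omega>" if "\<omega> \<in> weightings G" for \<omega>
  proof -
    have nonneg: "\<forall>e\<in>edges G. 0 \<le> \<omega> e" and "\<exists>e\<in>edges G. \<omega> e \<noteq> 0"
      using that by (auto simp: weightings_def)
    then have pos: "0 < weight \<omega> G"
      unfolding weight_def using finE
      by (metis (no_types, lifting) less_eq_real_def sum_nonneg sum_nonneg_eq_0_iff)
    obtain T where "is_spanning_tree G T" "m * weight \<omega> G \<le> weight \<omega> T"
      using exists_heavy_spanning_tree[OF assms(1,2) nonneg m0 m] by blast
    then have "m * weight \<omega> G \<le> weight \<omega> (max_spanning_tree G \<omega>)"
      using is_max_spanning_tree_max_spanning_tree[OF assms(1,2), of \<omega>]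
      unfolding is_max_spanning_tree_def by (meson order_trans)
    with pos show ?thesis by (simp add: weighting_ratio_def pos_le_divide_eq)
  qed
  \<comment> \<open>Since \<open>S\<close> attains the minimum, the total of this weighting is the
    denominator of \<open>m\<close>.\<close>
  define \<omega> :: "'a set \<Rightarrow> real" where "\<omega> e = of_bool (e \<subseteq> S)" for e
  have weight_\<omega>: "weight \<omega> H = card {e \<in> edges H. e \<subseteq> S}" if "finite (edges H)" for H
    using that by (simp add: weight_def \<omega>_def sum_of_bool_eq Int_def)
  have "\<exists>e\<in>edges G. e \<subseteq> S"
    using induced_edges_pos[OF assms(1) S(1,2)] finE
    by (auto simp: num_edges_def induced_def card_gt_0_iff)
  then have \<omega>_in: "\<omega> \<in> weightings G" by (auto simp: weightings_def \<omega>_def)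
  let ?T = "max_spanning_tree G \<omega>"
  have T: "simple_graph ?T" "\<nexists>vs. is_cycle ?T vs"
    using is_max_spanning_tree_max_spanning_tree[OF assms(1,2), of \<omega>]
    by (simp_all add: is_max_spanning_tree_def is_spanning_tree_def is_tree_def)
  \<comment> \<open>The tree may be disconnected on \<open>S\<close>, but its edges there still form
    a forest.\<close>
  have "card {e \<in> edges ?T. e \<subseteq> S} < card S"
  proof (rule forest_card_less)
    show "finite S" "S \<noteq> {}" using S(2) card.infinite by fastforce+
    show "forest {e \<in> edges ?T. e \<subseteq> S}"
      using acyclic_imp_forest[OF T] by (rule forest_mono) auto
  qed (use T(1) in \<open>auto simp: simple_graph_def\<close>)
  then have "weight \<omega> ?T \<le> real (card S) - 1"
    using weight_\<omega>[OF simple_graph_finite_edges[OF T(1)]] by simp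
  moreover have "weight \<omega> G = num_edges (induced G S)"
    using weight_\<omega>[OF finE] by (simp add: num_edges_def induced_def)
  ultimately have upper: "weighting_ratio G \<omega> \<le> m"
    using S(3) by (simp add: weighting_ratio_def divide_right_mono)
  have "(INF \<omega>\<in>weightings G. weighting_ratio G \<omega>) = m"
  proof (rule antisym)
    \<comment> \<open>The reals are only conditionally complete, so \<open>lower\<close> is needed
      here too, to bound the set of ratios from below.\<close>
    show "(INF \<omega>\<in>weightings G. weighting_ratio G \<omega>) \<le> m"
      using \<omega>_in upper bdd_belowI2[OF lower] by (intro cINF_lower2)
    show "m \<le> (INF \<omega>\<in>weightings G. weighting_ratio G \<omega>)"
      using \<omega>_in lower by (intro cINF_greatest) auto
  qed
  then show ?thesis by (simp only: m_def)
qed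

end
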